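(* Let $M=(C_1,\dots,C_n)$ be a multi-context system and let $C_i$ be a context of $M$ using ASP logic. Then the partial symmetries of $M$ with respect to $\{C_i\}$ correspond one-to-one to the symmetries (automorphisms) of the coloured graph $\mathrm{gap}(C_i)$.
   Context: An MCS $M=(C_1,\dots,C_n)$ consists of contexts $C_i=(L_i,kb_i,br_i)$, $L_i$ a logic over alphabet $\mathcal{A}_i$ (pairwise disjoint, $\mathcal{A}=\bigcup_i\mathcal{A}_i$), $kb_i$ a knowledge base and $br_i$ a set of bridge rules $a\leftarrow (c_1:b_1),\dots,(c_j:b_j),\mathrm{not}\,(c_{j+1}:b_{j+1}),\dots,\mathrm{not}\,(c_m:b_m)$ with $a\in\mathcal{A}_i$, $b_l\in\mathcal{A}_{c_l}$; $(c:b)$ is a context atom, and it or its default negation a context literal. $\mathrm{at}(br_i)$ is the set of atoms occurring in $br_i$. $C_i$ uses ASP logic: $kb_i$ is a disjunctive logic program, i.e. a finite set of rules $a_1;\dots;a_\ell\leftarrow b_1,\dots,b_j,\mathrm{not}\,b_{j+1},\dots,\mathrm{not}\,b_m$ over $\mathcal{A}_i$, belief sets are subsets of $\mathcal{A}_i$ and acceptable belief sets are answer sets. For a permutation $\pi$: $kb^\pi$ and $br^\pi$ are obtained by replacing each atom $a$ (including inside context atoms $(c:b)\mapsto(c:b^\pi)$) by $a^\pi$. A permutation $\pi$ of $S\subseteq\mathcal{A}$ is a partial symmetry of $M$ with respect to $\{C_i\}$ iff $\mathcal{A}_i\cup\mathrm{at}(br_i)\subseteq S$, $\mathcal{A}_i^\pi=\mathcal{A}_i$,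 $kb_i^\pi=kb_i$ and $br_i^\pi=br_i$. The directed vertex-coloured graph $\mathrm{gap}(C_i)$ (colours $1,\dots,n+3$) is built as follows: (1) every atom occurring in $kb_i\cup br_i$ is represented by two vertices, a positive-literal vertex of colour $i$ and a negative-literal vertex of colour $n+1$; every context atom $(c:b)$ in $br_i$ is represented by a positive-literal vertex of colour $c$ and a negative-literal vertex of colour $n+1$; (2) every rule of $kb_i$ is represented by a body vertex of colour $n+2$ and every bridge rule of $br_i$ by a body vertex of colour $n+3$, with directed edges from the vertices of the (context) literals in the rule's body to its body vertex and from the body vertex to the vertices of the atoms in the rule's head; (3) for every (context) atom there is a directed edge from its positive-literal vertex to its negative-literal vertex. A symmetry of this coloured graph is a permutation $\pi$ of its vertices such that $(u,v)^\pi$ is an edge iff $(u,v)$ is an edge, and every vertex is mapped to a vertex of the same colour.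
   Formalization: Partial symmetries on a fixed S are identified when they agree on atoms occurring in kb_i ∪ br_i (unused atoms could be permuted freely); the literal claim is given if all of A_i occurs and S = A_i ∪ at(br_i). An own atom a and the context atom (i:a) share vertices. *)

theory Defs
  imports
    "HOL-Library.FSet"
    "HOL-Combinatorics.Combinatorics"
    "Graph_Theory.Pair_Digraph"
begin

text \<open>The atoms of a head, of a positive body and of a negative body are finite sets, so rules
  that differ only in the order or multiplicity of their atoms are identified. The generated
  functions \<open>map_asp_rule\<close> and \<open>map_bridge_rule\<close> replace every atom \<open>a\<close> by \<open>\<pi> a\<close>, and
  \<open>set_asp_rule\<close> and \<open>set_bridge_rule\<close> yield the atoms of a rule. A context atom \<open>(c : b)\<close> is
  the pair \<open>(c, b)\<close>; its index \<open>c\<close> is not affected by these functions.\<close>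

datatype 'a asp_rule =
  ASP_Rule (heads: "'a fset") (pos_body: "'a fset") (neg_body: "'a fset")

datatype 'a bridge_rule =
  Bridge_Rule (bridge_head: 'a) (bridge_pos: "(nat \<times> 'a) fset") (bridge_neg: "(nat \<times> 'a) fset")

definition satisfies :: "'a set \<Rightarrow> 'a asp_rule \<Rightarrow> bool" where
  "satisfies X r \<longleftrightarrow>
     (fset (pos_body r) \<subseteq> X \<and> fset (neg_body r) \<inter> X = {} \<longrightarrow> fset (heads r) \<inter> X \<noteq> {})"

definition reduct :: "'a asp_rule set \<Rightarrow> 'a set \<Rightarrow> 'a asp_rule set" where
  "reduct P X =
     {ASP_Rule (heads r) (pos_body r) {||} | r. r \<in> P \<and> fset (neg_body r) \<inter> X = {}}"

definition answer_set :: "'a asp_rule set \<Rightarrow> 'a set \<Rightarrow> bool" where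
  "answer_set P X \<longleftrightarrow>
     (\<forall>r \<in> reduct P X. satisfies X r) \<and>
     (\<forall>Y. Y \<subset> X \<longrightarrow> \<not> (\<forall>r \<in> reduct P X. satisfies Y r))"

text \<open>Contexts of one system may use different logics, hence different kinds of formulas: a formula
  is either a rule of a logic program or an element of an arbitrary type \<open>'f\<close>.\<close>

datatype ('a, 'f) formula = Program_Rule "'a asp_rule" | Other 'f

record ('a, 'f) logic =
  alphabet :: "'a set"
  KB :: "('a, 'f) formula set set"
  BS :: "'a set set"
  ACC :: "('a, 'f) formula set \<Rightarrow> 'a set set"

definition wf_logic :: "('a, 'f) logic \<Rightarrow> bool" where
  "wf_logic L \<longleftrightarrow> BS L \<subseteq> Pow (alphabet L) \<and> (\<forall>kb \<in> KB L. ACC L kb \<subseteq> BS L)"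

definition asp_logic :: "'a set \<Rightarrow> ('a, 'f) logic" where
  "asp_logic A =
     \<lparr> alphabet = A,
       KB = {Program_Rule ` P | P. finite P \<and> (\<forall>r \<in> P. set_asp_rule r \<subseteq> A)},
       BS = Pow A,
       ACC = (\<lambda>kb. {X. X \<subseteq> A \<and> answer_set {r. Program_Rule r \<in> kb} X}) \<rparr>"

record ('a, 'f) mcs_context =
  logic :: "('a, 'f) logic"
  kb :: "('a, 'f) formula set"
  br :: "'a bridge_rule set"

type_synonym ('a, 'f) mcs = "('a, 'f) mcs_context list"

text \<open>Contexts are numbered from 1.\<close>

definition ctx :: "('a, 'f) mcs \<Rightarrow> nat \<Rightarrow> ('a, 'f) mcs_context" where
  "ctx M i = M ! (i - 1)"

definition alph :: "('a, 'f) mcs \<Rightarrow> nat \<Rightarrow> 'a set" where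
  "alph M i = alphabet (logic (ctx M i))"

definition is_mcs :: "('a, 'f) mcs \<Rightarrow> bool" where
  "is_mcs M \<longleftrightarrow>
     disjoint_family_on (alph M) {1..length M} \<and>
     (\<forall>i \<in> {1..length M}.
        wf_logic (logic (ctx M i)) \<and>
        kb (ctx M i) \<in> KB (logic (ctx M i)) \<and>
        (\<forall>r \<in> br (ctx M i).
           bridge_head r \<in> alph M i \<and>
           (\<forall>(c, b) \<in> fset (bridge_pos r) \<union> fset (bridge_neg r).
              c \<in> {1..length M} \<and> b \<in> alph M c)))"

definition uses_asp :: "('a, 'f) mcs_context \<Rightarrow> bool" where
  "uses_asp C \<longleftrightarrow> logic C = asp_logic (alphabet (logic C))"

text \<open>For a context using ASP logic, the knowledge base as a logic program.\<close>

definition program :: "('a, 'f) mcs_context \<Rightarrow> 'a asp_rule set" where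
  "program C = {r. Program_Rule r \<in> kb C}"

definition at_br :: "('a, 'f) mcs_context \<Rightarrow> 'a set" where
  "at_br C = (\<Union>r \<in> br C. set_bridge_rule r)"

definition occurring_atoms :: "('a, 'f) mcs_context \<Rightarrow> 'a set" where
  "occurring_atoms C = (\<Union>r \<in> program C. set_asp_rule r) \<union> at_br C"

text \<open>The sets on which a partial symmetry with respect to the \<open>i\<close>-th context may be defined.\<close>

definition admissible_domain :: "('a, 'f) mcs \<Rightarrow> nat \<Rightarrow> 'a set \<Rightarrow> bool" where
  "admissible_domain M i S \<longleftrightarrow>
     alph M i \<union> at_br (ctx M i) \<subseteq> S \<and> S \<subseteq> (\<Union>j \<in> {1..length M}. alph M j)"

text \<open>Only meant for an \<open>i\<close>-th context that uses ASP logic. Permutations are total functions that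
  are the identity outside \<open>S\<close>.\<close>

definition partial_symmetry :: "('a, 'f) mcs \<Rightarrow> nat \<Rightarrow> 'a set \<Rightarrow> ('a \<Rightarrow> 'a) \<Rightarrow> bool" where
  "partial_symmetry M i S \<pi> \<longleftrightarrow>
     \<pi> permutes S \<and> admissible_domain M i S \<and>
     \<pi> ` alph M i = alph M i \<and>
     map_asp_rule \<pi> ` program (ctx M i) = program (ctx M i) \<and>
     map_bridge_rule \<pi> ` br (ctx M i) = br (ctx M i)"

record 'v coloured_digraph = "'v pair_pre_digraph" +
  colour :: "'v \<Rightarrow> nat"

definition symmetries :: "'v coloured_digraph \<Rightarrow> ('v \<Rightarrow> 'v) set" where
  "symmetries G =
     {\<sigma>. \<sigma> permutes pverts G \<and>
         (\<forall>u \<in> pverts G. \<forall>v \<in> pverts G. (\<sigma> u, \<sigma> v) \<in> parcs G \<longleftrightarrow> (u, v) \<in> parcs G) \<and>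
         (\<forall>v \<in> pverts G. colour G (\<sigma> v) = colour G v)}"

datatype 'a gap_vertex =
    Pos "nat \<times> 'a"
  | Neg "nat \<times> 'a"
  | Body "'a asp_rule"
  | Bridge_Body "'a bridge_rule"

text \<open>An own atom \<open>a\<close> of the \<open>i\<close>-th context, occurring in the program or as the head of a bridge
  rule, is identified with the context atom \<open>(i : a)\<close>. An atom of another context occurs only
  inside context atoms and has no vertices besides those of the context atom.\<close>

definition gap_atoms :: "('a, 'f) mcs \<Rightarrow> nat \<Rightarrow> (nat \<times> 'a) set" where
  "gap_atoms M i =
     {(i, a) | a. a \<in> (\<Union>r \<in> program (ctx M i). set_asp_rule r) \<union> bridge_head ` br (ctx M i)} \<union>
     (\<Union>r \<in> br (ctx M i). fset (bridge_pos r) \<union> fset (bridge_neg r))"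

fun gap_colour :: "nat \<Rightarrow> 'a gap_vertex \<Rightarrow> nat" where
  "gap_colour n (Pos (c, a)) = c"
| "gap_colour n (Neg _) = n + 1"
| "gap_colour n (Body _) = n + 2"
| "gap_colour n (Bridge_Body _) = n + 3"

definition gap :: "('a, 'f) mcs \<Rightarrow> nat \<Rightarrow> 'a gap_vertex coloured_digraph" where
  "gap M i =
     \<lparr> pverts =
         Pos ` gap_atoms M i \<union> Neg ` gap_atoms M i \<union>
         Body ` program (ctx M i) \<union> Bridge_Body ` br (ctx M i),
       parcs =
         {(Pos (i, a), Body r) | a r. r \<in> program (ctx M i) \<and> a \<in> fset (pos_body r)} \<union>
         {(Neg (i, a), Body r) | a r. r \<in> program (ctx M i) \<and> a \<in> fset (neg_body r)} \<union>
         {(Body r, Pos (i, a)) | a r. r \<in> program (ctx M i) \<and> a \<in> fset (heads r)} \<union>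
         {(Pos p, Bridge_Body r) | p r. r \<in> br (ctx M i) \<and> p \<in> fset (bridge_pos r)} \<union>
         {(Neg p, Bridge_Body r) | p r. r \<in> br (ctx M i) \<and> p \<in> fset (bridge_neg r)} \<union>
         {(Bridge_Body r, Pos (i, bridge_head r)) | r. r \<in> br (ctx M i)} \<union>
         {(Pos p, Neg p) | p. p \<in> gap_atoms M i},
       colour = gap_colour (length M) \<rparr>"

definition gap_map :: "('a, 'f) mcs \<Rightarrow> nat \<Rightarrow> ('a \<Rightarrow> 'a) \<Rightarrow> 'a gap_vertex \<Rightarrow> 'a gap_vertex" where
  "gap_map M i \<pi> = perm_restrict (map_gap_vertex \<pi>) (pverts (gap M i))"

lemma gap_map_perm_restrict:
  "gap_map M i (perm_restrict \<pi> (occurring_atoms (ctx M i))) = gap_map M i \<pi>"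
proof -
  let ?C = "ctx M i"
  let ?\<rho> = "perm_restrict \<pi> (occurring_atoms ?C)"
  have eq: "?\<rho> a = \<pi> a" if "a \<in> occurring_atoms ?C" for a
    using that by (simp add: perm_restrict_def)
  have occ: "b \<in> occurring_atoms ?C" if "(c, b) \<in> gap_atoms M i" for c b
  proof -
    have 1: "bridge_head r \<in> set_bridge_rule r" for r :: "'a bridge_rule"
      by (cases r) simp
    have 2: "b \<in> set_bridge_rule r"
      if "(c, b) \<in> fset (bridge_pos r) \<union> fset (bridge_neg r)" for r
      using that by (cases r) force
    show ?thesis
      using that 1 2 unfolding gap_atoms_def occurring_atoms_def at_br_def by blast
  qed
  have "map_gap_vertex ?\<rho> v = map_gap_vertex \<pi> v" if v: "v \<in> pverts (gap M i)" for v
  proof (rule gap_vertex.map_cong0)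
    fix a assume "a \<in> set_gap_vertex v"
    have "a \<in> occurring_atoms ?C"
    proof (cases v)
      case (Pos p)
      then show ?thesis using v \<open>a \<in> set_gap_vertex v\<close> occ by (cases p) (auto simp: gap_def)
    next
      case (Neg p)
      then show ?thesis using v \<open>a \<in> set_gap_vertex v\<close> occ by (cases p) (auto simp: gap_def)
    qed (use v \<open>a \<in> set_gap_vertex v\<close> in
        \<open>auto simp: gap_def occurring_atoms_def at_br_def\<close>)
    then show "?\<rho> a = \<pi> a" by (rule eq)
  qed
  then show ?thesis
    by (auto simp: gap_map_def perm_restrict_def[of "map_gap_vertex _"])
qed

end

theory Submission
  imports Defs
begin

text \<open>A symmetry of the graph respects colours, so it sends positive-literal vertices to
  positive-literal vertices of the same context. As the alphabets are disjoint, its action on them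
  is that of a single permutation of the occurring atoms. The edge \<open>Pos p \<rightarrow> Neg p\<close> then fixes the
  action on the negative-literal vertices, and since a rule is determined by the edges at its body
  vertex, the action on the body vertices as well.\<close>

section \<open>Rules and the atoms occurring in them\<close>

lemma bridge_head_in_set: "bridge_head r \<in> set_bridge_rule r"
  by (cases r) simp

lemma context_atom_in_set:
  assumes "(c, b) \<in> fset (bridge_pos r) \<union> fset (bridge_neg r)"
  shows "b \<in> set_bridge_rule r"
  using assms by (cases r) force

lemma set_bridge_ruleE:
  assumes "b \<in> set_bridge_rule r"
  obtains "b = bridge_head r" | c where "(c, b) \<in> fset (bridge_pos r) \<union> fset (bridge_neg r)"
  using assms by (cases r) (auto, blast+)

text \<open>A rule consists of nothing but its three finite sets of atoms. The conditions are
  phrased with ordinary sets because the arcs at a body vertex yield membership statements.\<close>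

lemma map_asp_rule_eqI:
  assumes "fset (heads r') = \<pi> ` fset (heads r)"
    and "fset (pos_body r') = \<pi> ` fset (pos_body r)"
    and "fset (neg_body r') = \<pi> ` fset (neg_body r)"
  shows "r' = map_asp_rule \<pi> r"
  using assms by (cases r, cases r') (auto simp: fset_inject[symmetric])

lemma map_bridge_rule_eqI:
  assumes "bridge_head r' = \<pi> (bridge_head r)"
    and "fset (bridge_pos r') = map_prod id \<pi> ` fset (bridge_pos r)"
    and "fset (bridge_neg r') = map_prod id \<pi> ` fset (bridge_neg r)"
  shows "r' = map_bridge_rule \<pi> r"
  using assms by (cases r, cases r') (auto simp: fset_inject[symmetric])

section \<open>Vertices and arcs of the graph\<close>

text \<open>Body vertices of program rules are joined to own atoms only, hence the condition
  \<open>fst p = i\<close>. For the body of a bridge rule the index is already part of the context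
  atom.\<close>

lemma gap_arc_simps:
  "(Pos p, Body r) \<in> parcs (gap M i) \<longleftrightarrow>
     r \<in> program (ctx M i) \<and> fst p = i \<and> snd p \<in> fset (pos_body r)"
  "(Neg p, Body r) \<in> parcs (gap M i) \<longleftrightarrow>
     r \<in> program (ctx M i) \<and> fst p = i \<and> snd p \<in> fset (neg_body r)"
  "(Body r, Pos p) \<in> parcs (gap M i) \<longleftrightarrow>
     r \<in> program (ctx M i) \<and> fst p = i \<and> snd p \<in> fset (heads r)"
  "(Pos p, Bridge_Body s) \<in> parcs (gap M i) \<longleftrightarrow> s \<in> br (ctx M i) \<and> p \<in> fset (bridge_pos s)"
  "(Neg p, Bridge_Body s) \<in> parcs (gap M i) \<longleftrightarrow> s \<in> br (ctx M i) \<and> p \<in> fset (bridge_neg s)"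
  "(Bridge_Body s, Pos p) \<in> parcs (gap M i) \<longleftrightarrow> s \<in> br (ctx M i) \<and> p = (i, bridge_head s)"
  "(Pos p, Neg q) \<in> parcs (gap M i) \<longleftrightarrow> p = q \<and> p \<in> gap_atoms M i"
  by (cases p; auto simp: gap_def)+

lemma gap_vertex_simps:
  "Pos p \<in> pverts (gap M i) \<longleftrightarrow> p \<in> gap_atoms M i"
  "Neg p \<in> pverts (gap M i) \<longleftrightarrow> p \<in> gap_atoms M i"
  "Body r \<in> pverts (gap M i) \<longleftrightarrow> r \<in> program (ctx M i)"
  "Bridge_Body s \<in> pverts (gap M i) \<longleftrightarrow> s \<in> br (ctx M i)"
  by (auto simp: gap_def)

lemma gap_atomsI:
  "r \<in> program (ctx M i) \<Longrightarrow>
     a \<in> fset (heads r) \<or> a \<in> fset (pos_body r) \<or> a \<in> fset (neg_body r) \<Longrightarrow>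
     (i, a) \<in> gap_atoms M i"
  "s \<in> br (ctx M i) \<Longrightarrow> (i, bridge_head s) \<in> gap_atoms M i"
  "s \<in> br (ctx M i) \<Longrightarrow>
     p \<in> fset (bridge_pos s) \<or> p \<in> fset (bridge_neg s) \<Longrightarrow> p \<in> gap_atoms M i"
proof -
  show "(i, a) \<in> gap_atoms M i"
    if "r \<in> program (ctx M i)"
      "a \<in> fset (heads r) \<or> a \<in> fset (pos_body r) \<or> a \<in> fset (neg_body r)"
  proof -
    have "a \<in> set_asp_rule r"
      using that(2) by (cases r) auto
    then show ?thesis
      using that(1) unfolding gap_atoms_def by blast
  qed
qed (auto simp: gap_atoms_def)

lemma gap_arc_in_pverts:
  assumes "(u, v) \<in> parcs (gap M i)"
  shows "u \<in> pverts (gap M i) \<and> v \<in> pverts (gap M i)"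
  using assms unfolding gap_def by (auto intro: gap_atomsI)

section \<open>Permutations preserving the rules act on the graph\<close>

text \<open>Renaming commutes with taking the atoms of a rule and leaves indices alone. Only
  inclusions are assumed, so that the lemma serves a permutation and its inverse alike.\<close>

lemma map_gap_atoms:
  assumes "map_asp_rule \<pi> ` program (ctx M i) \<subseteq> program (ctx M i)"
    and "map_bridge_rule \<pi> ` br (ctx M i) \<subseteq> br (ctx M i)"
    and "p \<in> gap_atoms M i"
  shows "map_prod id \<pi> p \<in> gap_atoms M i"
proof -
  obtain c a where p: "p = (c, a)" by (cases p)
  consider (own) r where "r \<in> program (ctx M i)" "c = i" "a \<in> set_asp_rule r"
    | (head) r where "r \<in> br (ctx M i)" "c = i" "a = bridge_head r"
    | (pos) r where "r \<in> br (ctx M i)" "(c, a) \<in> fset (bridge_pos r)"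
    | (neg) r where "r \<in> br (ctx M i)" "(c, a) \<in> fset (bridge_neg r)"
    using assms(3) unfolding p gap_atoms_def by blast
  then show ?thesis
  proof cases
    case own
    then have "map_asp_rule \<pi> r \<in> program (ctx M i)" "\<pi> a \<in> set_asp_rule (map_asp_rule \<pi> r)"
      using assms(1) by (auto simp: asp_rule.set_map)
    then show ?thesis using own by (auto simp: p gap_atoms_def)
  next
    case head
    then have "map_bridge_rule \<pi> r \<in> br (ctx M i)" "\<pi> a = bridge_head (map_bridge_rule \<pi> r)"
      using assms(2) by (auto simp: bridge_rule.map_sel)
    then show ?thesis using head by (auto simp: p gap_atoms_def)
  next
    case pos
    then have "map_bridge_rule \<pi> r \<in> br (ctx M i)"
      "(c, \<pi> a) \<in> fset (bridge_pos (map_bridge_rule \<pi> r))"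
      using assms(2) by (force simp: bridge_rule.map_sel)+
    then show ?thesis by (auto simp: p gap_atoms_def)
  next
    case neg
    then have "map_bridge_rule \<pi> r \<in> br (ctx M i)"
      "(c, \<pi> a) \<in> fset (bridge_neg (map_bridge_rule \<pi> r))"
      using assms(2) by (force simp: bridge_rule.map_sel)+
    then show ?thesis by (auto simp: p gap_atoms_def)
  qed
qed

lemma map_gap_vertex_in_pverts:
  assumes "map_asp_rule \<pi> ` program (ctx M i) \<subseteq> program (ctx M i)"
    and "map_bridge_rule \<pi> ` br (ctx M i) \<subseteq> br (ctx M i)"
    and "v \<in> pverts (gap M i)"
  shows "map_gap_vertex \<pi> v \<in> pverts (gap M i)"
  using assms(3) map_gap_atoms[OF assms(1,2)] assms(1,2)
  by (cases v) (auto simp: gap_vertex_simps)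

text \<open>Arcs express membership in the parts of a rule, and the selectors of these parts commute
  with renaming. The converse implication will come from the inverse permutation.\<close>

lemma map_gap_vertex_arc:
  assumes "map_asp_rule \<pi> ` program (ctx M i) \<subseteq> program (ctx M i)"
    and "map_bridge_rule \<pi> ` br (ctx M i) \<subseteq> br (ctx M i)"
    and "(u, v) \<in> parcs (gap M i)"
  shows "(map_gap_vertex \<pi> u, map_gap_vertex \<pi> v) \<in> parcs (gap M i)"
proof -
  have "map_asp_rule \<pi> r \<in> program (ctx M i)" if "r \<in> program (ctx M i)" for r
    using that assms(1) by blast
  moreover have "map_bridge_rule \<pi> r \<in> br (ctx M i)" if "r \<in> br (ctx M i)" for r
    using that assms(2) by blast
  moreover have "(map_gap_vertex \<pi> u, map_gap_vertex \<pi> v) \<in> parcs (gap M i)"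
    if "u = Pos p" "v = Neg p" "p \<in> gap_atoms M i" for p
    using that map_gap_atoms[OF assms(1,2)] by (simp add: gap_arc_simps)
  ultimately show ?thesis
    using assms(3) unfolding gap_def
    by (auto simp: gap_arc_simps[unfolded gap_def] asp_rule.map_sel bridge_rule.map_sel
        intro!: image_eqI, auto)
qed

lemma gap_colour_map: "gap_colour n (map_gap_vertex \<pi> v) = gap_colour n v"
  by (cases v) auto

text \<open>The inverse of \<open>\<pi>\<close> preserves both sets of rules as well. Its action
  therefore inverts that of \<open>\<pi>\<close> on the vertices and shows that arcs are also
  reflected.\<close>

lemma map_gap_vertex_symmetry:
  assumes "bij \<pi>"
    and prog: "map_asp_rule \<pi> ` program (ctx M i) = program (ctx M i)"
    and br: "map_bridge_rule \<pi> ` br (ctx M i) = br (ctx M i)"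
  shows "gap_map M i \<pi> \<in> symmetries (gap M i)"
proof -
  let ?V = "pverts (gap M i)" and ?f = "map_gap_vertex \<pi>" and ?g = "map_gap_vertex (inv \<pi>)"
  have inv: "inv \<pi> \<circ> \<pi> = id" "\<pi> \<circ> inv \<pi> = id"
    using bij_is_inj[OF assms(1)] bij_is_surj[OF assms(1)] by (simp_all only: inv_o_cancel surj_iff)
  have gf: "?g (?f v) = v" and fg: "?f (?g v) = v" for v
    by (simp_all add: gap_vertex.map_comp inv gap_vertex.map_id)
  have "map_asp_rule (inv \<pi>) ` map_asp_rule \<pi> ` program (ctx M i) = program (ctx M i)"
    by (simp add: image_image asp_rule.map_comp inv asp_rule.map_id)
  then have prog': "map_asp_rule (inv \<pi>) ` program (ctx M i) \<subseteq> program (ctx M i)"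
    by (simp add: prog)
  have "map_bridge_rule (inv \<pi>) ` map_bridge_rule \<pi> ` br (ctx M i) = br (ctx M i)"
    by (simp add: image_image bridge_rule.map_comp inv bridge_rule.map_id)
  then have br': "map_bridge_rule (inv \<pi>) ` br (ctx M i) \<subseteq> br (ctx M i)"
    by (simp add: br)
  note f = map_gap_vertex_in_pverts[OF equalityD1[OF prog] equalityD1[OF br]]
  note g = map_gap_vertex_in_pverts[OF prog' br']
  have arc: "(?f u, ?f v) \<in> parcs (gap M i) \<longleftrightarrow> (u, v) \<in> parcs (gap M i)" for u v
    using map_gap_vertex_arc[OF equalityD1[OF prog] equalityD1[OF br]]
      map_gap_vertex_arc[OF prog' br', of "?f u" "?f v"] by (auto simp: gf)
  have eq: "gap_map M i \<pi> v = ?f v" if "v \<in> ?V" for v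
    using that by (simp add: gap_map_def perm_restrict_def)
  have "bij_betw ?f ?V ?V"
    using f g gf fg by (intro bij_betw_byWitness[where f' = ?g]) auto
  then have "bij_betw (gap_map M i \<pi>) ?V ?V"
    by (simp cong: bij_betw_cong add: eq)
  then have "gap_map M i \<pi> permutes ?V"
    \<comment> \<open>Here the restriction in \<open>gap_map\<close> matters:
      \<open>map_gap_vertex \<pi>\<close> alone may move values that are not vertices of the
      graph.\<close>
    by (rule bij_imp_permutes) (simp add: gap_map_def perm_restrict_def)
  moreover have "colour (gap M i) (?f v) = colour (gap M i) v" for v
    by (simp add: gap_def gap_colour_map)
  ultimately show ?thesis
    by (simp add: symmetries_def eq arc)
qed

section \<open>Occurring atoms and disjoint alphabets\<close>

locale asp_context =
  fixes M :: "('a, 'f) mcs" and i :: nat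
  assumes mcs: "is_mcs M" and index: "i \<in> {1..length M}" and asp: "uses_asp (ctx M i)"
begin

abbreviation "occ \<equiv> occurring_atoms (ctx M i)"

lemma program_alph:
  assumes "r \<in> program (ctx M i)"
  shows "set_asp_rule r \<subseteq> alph M i"
proof -
  have "kb (ctx M i) \<in> KB (asp_logic (alph M i))"
    using mcs index asp unfolding is_mcs_def uses_asp_def alph_def by force
  then show ?thesis
    using assms by (auto simp: asp_logic_def program_def)
qed

lemma bridge_alph:
  assumes "r \<in> br (ctx M i)"
  shows "bridge_head r \<in> alph M i"
    and "(c, b) \<in> fset (bridge_pos r) \<union> fset (bridge_neg r) \<Longrightarrow>
      c \<in> {1..length M} \<and> b \<in> alph M c"
  using mcs index assms unfolding is_mcs_def by blast+

lemma gap_atoms_alph: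
  assumes "(c, b) \<in> gap_atoms M i"
  shows "c \<in> {1..length M}" "b \<in> alph M c"
  using assms index program_alph bridge_alph unfolding gap_atoms_def by blast+

lemma alph_unique:
  assumes "b \<in> alph M c" "b \<in> alph M d" "c \<in> {1..length M}" "d \<in> {1..length M}"
  shows "c = d"
  using assms mcs unfolding is_mcs_def disjoint_family_on_def by blast

text \<open>By disjointness of the alphabets an atom determines its index. This is what turns an
  index-preserving map on indexed atoms into a map on plain atoms.\<close>

lemma gap_atoms_unique:
  assumes "(c, b) \<in> gap_atoms M i" "(d, b) \<in> gap_atoms M i"
  shows "c = d"
  using assms gap_atoms_alph alph_unique by blast

lemma occ_iff: "b \<in> occ \<longleftrightarrow> (\<exists>c. (c, b) \<in> gap_atoms M i)"
proof
  assume "b \<in> occ"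
  then consider (own) r where "r \<in> program (ctx M i)" "b \<in> set_asp_rule r"
    | (bridge) r where "r \<in> br (ctx M i)" "b \<in> set_bridge_rule r"
    unfolding occurring_atoms_def at_br_def by blast
  then show "\<exists>c. (c, b) \<in> gap_atoms M i"
  proof cases
    case own
    then show ?thesis unfolding gap_atoms_def by blast
  next
    case bridge
    from bridge(2) show ?thesis
      by (rule set_bridge_ruleE) (use gap_atomsI(2,3)[OF bridge(1)] in blast)+
  qed
next
  assume "\<exists>c. (c, b) \<in> gap_atoms M i"
  then obtain c where "(c, b) \<in> gap_atoms M i" ..
  then consider (own) r where "r \<in> program (ctx M i)" "b \<in> set_asp_rule r"
    | (head) r where "r \<in> br (ctx M i)" "b = bridge_head r"
    | (body) r where "r \<in> br (ctx M i)" "(c, b) \<in> fset (bridge_pos r) \<union> fset (bridge_neg r)"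
    unfolding gap_atoms_def by blast
  then show "b \<in> occ"
  proof cases
    case own
    then show ?thesis by (auto simp: occurring_atoms_def)
  next
    case head
    then show ?thesis using bridge_head_in_set by (auto simp: occurring_atoms_def at_br_def)
  next
    case body
    then show ?thesis
      using context_atom_in_set[OF body(2)] by (auto simp: occurring_atoms_def at_br_def)
  qed
qed

lemma occE:
  assumes "b \<in> occ"
  obtains c where "(c, b) \<in> gap_atoms M i"
  using assms by (auto simp: occ_iff)

lemma occ_subset: "occ \<subseteq> alph M i \<union> at_br (ctx M i)"
  using program_alph unfolding occurring_atoms_def by blast

text \<open>Atoms of other contexts enter through context atoms, which refer to alphabets of the
  system. This provides the domain for the second half of the theorem.\<close>

lemma admissible_least: "admissible_domain M i (alph M i \<union> at_br (ctx M i))"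
proof -
  have "at_br (ctx M i) \<subseteq> occ"
    by (simp add: occurring_atoms_def)
  also have "\<dots> \<subseteq> (\<Union>j \<in> {1..length M}. alph M j)"
  proof
    fix b assume "b \<in> occ"
    then obtain c where "(c, b) \<in> gap_atoms M i"
      by (rule occE)
    then show "b \<in> (\<Union>j \<in> {1..length M}. alph M j)"
      using gap_atoms_alph by blast
  qed
  finally show ?thesis
    using index unfolding admissible_domain_def by blast
qed

section \<open>Recovering permutations of atoms from the graph\<close>

text \<open>The image of \<open>Pos (c, b)\<close> reveals \<open>\<pi> b\<close>. Atoms that do not
  occur have no vertex, so agreement is obtained on \<open>occ\<close> only.\<close>

lemma gap_map_inj:
  assumes "gap_map M i \<pi> = gap_map M i \<rho>"
  shows "perm_restrict \<pi> occ = perm_restrict \<rho> occ"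
proof -
  have "\<pi> b = \<rho> b" if "b \<in> occ" for b
  proof -
    obtain c where "(c, b) \<in> gap_atoms M i"
      using \<open>b \<in> occ\<close> by (rule occE)
    then show ?thesis
      using fun_cong[OF assms, of "Pos (c, b)"]
      by (simp add: gap_map_def perm_restrict_def gap_vertex_simps)
  qed
  then show ?thesis
    by (auto simp: perm_restrict_def)
qed

text \<open>Context indices are at most \<open>length M\<close>, while all other kinds of vertices
  have larger colours. Colour \<open>c\<close> thus forces a positive-literal vertex with index
  \<open>c\<close>.\<close>

lemma symmetry_Pos:
  assumes "\<sigma> \<in> symmetries (gap M i)" and cb: "(c, b) \<in> gap_atoms M i"
  obtains b' where "\<sigma> (Pos (c, b)) = Pos (c, b')"
proof -
  have v: "Pos (c, b) \<in> pverts (gap M i)"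
    using cb by (simp add: gap_vertex_simps)
  then have "colour (gap M i) (\<sigma> (Pos (c, b))) = colour (gap M i) (Pos (c, b))"
    using assms(1) by (simp add: symmetries_def)
  then show thesis
    using that gap_atoms_alph[OF cb] by (cases "\<sigma> (Pos (c, b))") (auto simp: gap_def)
qed

text \<open>This is the core of surjectivity. The permutation obtained moves occurring atoms only,
  so it also permutes every admissible domain.\<close>

lemma symmetry_induced:
  assumes sym: "\<sigma> \<in> symmetries (gap M i)"
  obtains \<pi> where "\<pi> permutes occ"
    and "\<And>v. v \<in> pverts (gap M i) \<Longrightarrow> \<sigma> v = map_gap_vertex \<pi> v"
proof -
  let ?V = "pverts (gap M i)" and ?A = "parcs (gap M i)"
  have perm: "\<sigma> permutes ?V"
    and arc: "\<And>u v. u \<in> ?V \<Longrightarrow> v \<in> ?V \<Longrightarrow> (\<sigma> u, \<sigma> v) \<in> ?A \<longleftrightarrow> (u, v) \<in> ?A"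
    and col: "\<And>v. v \<in> ?V \<Longrightarrow> gap_colour (length M) (\<sigma> v) = gap_colour (length M) v"
    using sym by (auto simp: symmetries_def gap_def)
  have in_V: "\<sigma> v \<in> ?V" if "v \<in> ?V" for v
    using that perm by (simp add: permutes_in_image)
  \<comment> \<open>This bound later excludes \<open>Pos\<close> as the form of an image whose
    colour exceeds \<open>length M\<close>.\<close>
  have colour_Pos: "gap_colour (length M) (Pos p) \<le> length M" if "Pos p \<in> ?V" for p
    using that gap_atoms_alph by (cases p) (force simp: gap_vertex_simps)
  have arc': "(\<sigma> u, \<sigma> v) \<in> ?A" if "(u, v) \<in> ?A" for u v
    using that arc gap_arc_in_pverts by blast
  \<comment> \<open>One value \<open>b'\<close> serves all indices \<open>c\<close> because there is
    at most one. Off \<open>occ\<close> the default is \<open>b\<close> itself, which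
    \<open>permutes\<close> will require.\<close>
  have "\<exists>b'. (\<forall>c. (c, b) \<in> gap_atoms M i \<longrightarrow> \<sigma> (Pos (c, b)) = Pos (c, b')) \<and> (b \<notin> occ \<longrightarrow> b' = b)"
    for b
  proof (cases "b \<in> occ")
    case True
    then obtain c where c: "(c, b) \<in> gap_atoms M i"
      by (rule occE)
    then obtain b' where "\<sigma> (Pos (c, b)) = Pos (c, b')"
      by (rule symmetry_Pos[OF sym])
    with True gap_atoms_unique[OF c] show ?thesis
      by blast
  qed (auto simp: occ_iff)
  then obtain \<pi> where Pos: "\<And>c b. (c, b) \<in> gap_atoms M i \<Longrightarrow> \<sigma> (Pos (c, b)) = Pos (c, \<pi> b)"
    and id: "\<And>b. b \<notin> occ \<Longrightarrow> \<pi> b = b"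
    by metis
  have atoms: "(c, \<pi> b) \<in> gap_atoms M i" if "(c, b) \<in> gap_atoms M i" for c b
    using in_V[of "Pos (c, b)"] that by (simp add: gap_vertex_simps Pos)
  \<comment> \<open>The colour makes the image a negative-literal vertex, and the only
    positive-literal vertex with an arc to \<open>Neg q\<close> is \<open>Pos q\<close>.\<close>
  have Neg: "\<sigma> (Neg (c, b)) = Neg (c, \<pi> b)" if cb: "(c, b) \<in> gap_atoms M i" for c b
  proof -
    have V: "Neg (c, b) \<in> ?V" and A: "(Pos (c, \<pi> b), \<sigma> (Neg (c, b))) \<in> ?A"
      using cb arc'[of "Pos (c, b)" "Neg (c, b)"]
      by (simp_all add: gap_vertex_simps gap_arc_simps Pos)
    obtain q where "\<sigma> (Neg (c, b)) = Neg q"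
      using col[OF V] in_V[OF V] colour_Pos by (cases "\<sigma> (Neg (c, b))") force+
    then show ?thesis
      using A by (simp add: gap_arc_simps)
  qed
  \<comment> \<open>A vertex mapped to a positive-literal vertex is itself one, by its colour. So
    surjectivity of \<open>\<sigma>\<close> passes to \<open>\<pi>\<close>, separately for each
    index.\<close>
  have pre: "\<exists>b. (c, b) \<in> gap_atoms M i \<and> b' = \<pi> b" if "(c, b') \<in> gap_atoms M i" for c b'
  proof -
    have "inv \<sigma> (Pos (c, b')) \<in> ?V"
      using that permutes_inv[OF perm] by (simp add: permutes_in_image gap_vertex_simps)
    then obtain v where v: "v \<in> ?V" "\<sigma> v = Pos (c, b')"
      using perm by (metis permutes_inverses(1))
    then have "gap_colour (length M) v \<le> length M"
      using col[of v] colour_Pos[of "(c, b')"] that by (simp add: gap_vertex_simps)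
    then obtain d b where "v = Pos (d, b)"
      by (cases v) auto
    then show ?thesis
      using v Pos[of d b] by (auto simp: gap_vertex_simps)
  qed
  have Body: "\<sigma> (Body r) = Body (map_asp_rule \<pi> r)" if r: "r \<in> program (ctx M i)" for r
  proof -
    have V: "Body r \<in> ?V"
      using r by (simp add: gap_vertex_simps)
    obtain r' where r': "\<sigma> (Body r) = Body r'"
      using col[OF V] in_V[OF V] colour_Pos by (cases "\<sigma> (Body r)") force+
    have P: "r' \<in> program (ctx M i)"
      using in_V[OF V] by (simp add: r' gap_vertex_simps)
    have iff: "\<pi> a \<in> fset (heads r') \<longleftrightarrow> a \<in> fset (heads r)"
      "\<pi> a \<in> fset (pos_body r') \<longleftrightarrow> a \<in> fset (pos_body r)"
      "\<pi> a \<in> fset (neg_body r') \<longleftrightarrow> a \<in> fset (neg_body r)"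
      if "(i, a) \<in> gap_atoms M i" for a
      using arc[of "Body r" "Pos (i, a)"] arc[of "Pos (i, a)" "Body r"]
        arc[of "Neg (i, a)" "Body r"] that r P
      by (simp_all add: gap_vertex_simps gap_arc_simps Pos Neg r')
    \<comment> \<open>The equivalences speak only about atoms of the form \<open>\<pi> a\<close>;
      \<open>pre\<close> shows that every atom of the image rule has this form.\<close>
    have "X' = \<pi> ` X"
      if "\<And>a. a \<in> X \<Longrightarrow> (i, a) \<in> gap_atoms M i" and X': "\<And>a. a \<in> X' \<Longrightarrow> (i, a) \<in> gap_atoms M i"
        and X_iff: "\<And>a. (i, a) \<in> gap_atoms M i \<Longrightarrow> \<pi> a \<in> X' \<longleftrightarrow> a \<in> X" for X X'
    proof (intro equalityI subsetI)
      fix a' assume a': "a' \<in> X'"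
      then obtain a where "(i, a) \<in> gap_atoms M i" "a' = \<pi> a"
        using X' pre by blast
      then show "a' \<in> \<pi> ` X"
        using X_iff a' by blast
    qed (use that in auto)
    then have "r' = map_asp_rule \<pi> r"
      using iff gap_atomsI(1)[OF r] gap_atomsI(1)[OF P]
      by (intro map_asp_rule_eqI) simp_all
    then show ?thesis
      by (simp add: r')
  qed
  have Bridge: "\<sigma> (Bridge_Body r) = Bridge_Body (map_bridge_rule \<pi> r)" if r: "r \<in> br (ctx M i)" for r
  proof -
    have V: "Bridge_Body r \<in> ?V"
      using r by (simp add: gap_vertex_simps)
    obtain r' where r': "\<sigma> (Bridge_Body r) = Bridge_Body r'"
      using col[OF V] in_V[OF V] colour_Pos by (cases "\<sigma> (Bridge_Body r)") force+
    have P: "r' \<in> br (ctx M i)"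
      using in_V[OF V] by (simp add: r' gap_vertex_simps)
    have iff: "(c, \<pi> b) \<in> fset (bridge_pos r') \<longleftrightarrow> (c, b) \<in> fset (bridge_pos r)"
      "(c, \<pi> b) \<in> fset (bridge_neg r') \<longleftrightarrow> (c, b) \<in> fset (bridge_neg r)"
      if "(c, b) \<in> gap_atoms M i" for c b
      using arc[of "Pos (c, b)" "Bridge_Body r"] arc[of "Neg (c, b)" "Bridge_Body r"] that r P
      by (simp_all add: gap_vertex_simps gap_arc_simps Pos Neg r')
    have "bridge_head r' = \<pi> (bridge_head r)"
      using arc[of "Bridge_Body r" "Pos (i, bridge_head r)"] gap_atomsI(2)[OF r] r P
      by (simp add: gap_vertex_simps gap_arc_simps Pos r')
    moreover have "X' = map_prod id \<pi> ` X"
      if "X \<subseteq> gap_atoms M i" and X': "X' \<subseteq> gap_atoms M i"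
        and X_iff: "\<And>c b. (c, b) \<in> gap_atoms M i \<Longrightarrow> (c, \<pi> b) \<in> X' \<longleftrightarrow> (c, b) \<in> X" for X X'
    proof (intro equalityI subsetI)
      fix p assume p: "p \<in> X'"
      obtain c b' where c: "p = (c, b')" by (cases p)
      then obtain b where "(c, b) \<in> gap_atoms M i" "b' = \<pi> b"
        using X' pre p by blast
      then show "p \<in> map_prod id \<pi> ` X"
        using X_iff p c by force
    qed (use that in auto)
    ultimately have "r' = map_bridge_rule \<pi> r"
      using iff gap_atomsI(3)[OF r] gap_atomsI(3)[OF P]
      by (intro map_bridge_rule_eqI) (simp_all add: subset_iff)
    then show ?thesis
      by (simp add: r')
  qed
  have eq: "\<sigma> v = map_gap_vertex \<pi> v" if "v \<in> ?V" for v
    using that Body Bridge Pos Neg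
    by (cases v) (auto simp: gap_vertex_simps split_paired_all)
  have "inj_on \<pi> occ"
  proof (rule inj_onI)
    fix a b assume "a \<in> occ" "b \<in> occ" and ab: "\<pi> a = \<pi> b"
    then obtain c d where cd: "(c, a) \<in> gap_atoms M i" "(d, b) \<in> gap_atoms M i"
      by (elim occE)
    \<comment> \<open>The common value \<open>\<pi> a = \<pi> b\<close> carries both indices, so
      they agree, and injectivity of \<open>\<sigma>\<close> becomes applicable.\<close>
    then have "c = d"
      using atoms gap_atoms_unique ab by metis
    with cd ab have "\<sigma> (Pos (c, a)) = \<sigma> (Pos (c, b))"
      by (simp add: Pos)
    then show "a = b"
      using permutes_inj[OF perm] by (auto dest: injD)
  qed
  moreover have "\<pi> ` occ = occ"
    using atoms pre by (fastforce simp: occ_iff image_iff)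
  ultimately have "\<pi> permutes occ"
    using id by (intro bij_imp_permutes) (auto simp: bij_betw_def)
  then show thesis
    using eq that by blast
qed

text \<open>\<open>map_gap_vertex\<close> keeps the kind of a vertex, so its bijectivity on the
  whole graph restricts to body vertices and gives invariance of the program and of the bridge
  rules.\<close>

lemma induced_partial_symmetry:
  assumes "admissible_domain M i S" and "\<sigma> \<in> symmetries (gap M i)"
    and \<pi>: "\<pi> permutes occ"
    and eq: "\<And>v. v \<in> pverts (gap M i) \<Longrightarrow> \<sigma> v = map_gap_vertex \<pi> v"
  shows "partial_symmetry M i S \<pi>"
proof -
  have perm: "\<sigma> permutes pverts (gap M i)"
    using assms(2) by (simp add: symmetries_def)
  have image: "map_gap_vertex \<pi> ` pverts (gap M i) = pverts (gap M i)"
    using permutes_image[OF perm] eq by (simp cong: image_cong)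
  have in_V: "map_gap_vertex \<pi> v \<in> pverts (gap M i)" if "v \<in> pverts (gap M i)" for v
    using that image by blast
  have pre: "\<exists>u \<in> pverts (gap M i). v = map_gap_vertex \<pi> u" if "v \<in> pverts (gap M i)" for v
    using that image by blast
  have prog: "map_asp_rule \<pi> ` program (ctx M i) = program (ctx M i)"
  proof (intro equalityI subsetI)
    fix r assume "r \<in> program (ctx M i)"
    then obtain u where "u \<in> pverts (gap M i)" "Body r = map_gap_vertex \<pi> u"
      using pre by (metis gap_vertex_simps(3))
    then show "r \<in> map_asp_rule \<pi> ` program (ctx M i)"
      by (cases u) (auto simp: gap_vertex_simps)
  next
    fix r assume "r \<in> map_asp_rule \<pi> ` program (ctx M i)"
    then obtain s where "s \<in> program (ctx M i)" "r = map_asp_rule \<pi> s" by blast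
    then show "r \<in> program (ctx M i)"
      using in_V[of "Body s"] by (simp add: gap_vertex_simps)
  qed
  have br: "map_bridge_rule \<pi> ` br (ctx M i) = br (ctx M i)"
  proof (intro equalityI subsetI)
    fix r assume "r \<in> br (ctx M i)"
    then obtain u where "u \<in> pverts (gap M i)" "Bridge_Body r = map_gap_vertex \<pi> u"
      using pre by (metis gap_vertex_simps(4))
    then show "r \<in> map_bridge_rule \<pi> ` br (ctx M i)"
      by (cases u) (auto simp: gap_vertex_simps)
  next
    fix r assume "r \<in> map_bridge_rule \<pi> ` br (ctx M i)"
    then obtain s where "s \<in> br (ctx M i)" "r = map_bridge_rule \<pi> s" by blast
    then show "r \<in> br (ctx M i)"
      using in_V[of "Bridge_Body s"] by (simp add: gap_vertex_simps)
  qed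
  \<comment> \<open>An occurring atom lies in the alphabet of context \<open>i\<close> exactly if
    its index is \<open>i\<close>, and \<open>\<pi>\<close> preserves the index. All other atoms are
    fixed.\<close>
  have alph_iff: "\<pi> b \<in> alph M i \<longleftrightarrow> b \<in> alph M i" for b
  proof (cases "b \<in> occ")
    case True
    then obtain c where c: "(c, b) \<in> gap_atoms M i"
      by (rule occE)
    then have "(c, \<pi> b) \<in> gap_atoms M i"
      using map_gap_atoms[of \<pi> M i "(c, b)"] prog br by simp
    with c show ?thesis
      using gap_atoms_alph alph_unique index by metis
  qed (use \<pi> in \<open>simp add: permutes_not_in\<close>)
  have "\<pi> ` alph M i = alph M i"
  proof (intro equalityI subsetI)
    fix b assume b: "b \<in> alph M i"
    obtain a where "b = \<pi> a"
      using permutes_surj[OF \<pi>] by (rule surjE)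
    then show "b \<in> \<pi> ` alph M i"
      using b by (simp add: alph_iff)
  qed (auto simp: alph_iff)
  moreover have "\<pi> permutes S"
    using occ_subset assms(1) unfolding admissible_domain_def
    by (intro permutes_subset[OF \<pi>]) blast
  ultimately show ?thesis
    using assms(1) prog br by (simp add: partial_symmetry_def)
qed

section \<open>The one-to-one correspondence\<close>

text \<open>Partial symmetries that agree on the occurring atoms induce the same graph symmetry.
  Restricting them to \<open>occ\<close> selects one representative per class and makes the map
  injective.\<close>

lemma gap_map_bij:
  assumes "admissible_domain M i S"
  shows "bij_betw (gap_map M i) {perm_restrict \<pi> occ | \<pi>. partial_symmetry M i S \<pi>}
    (symmetries (gap M i))"
  unfolding bij_betw_def
proof (intro conjI equalityI subsetI)
  show "inj_on (gap_map M i) {perm_restrict \<pi> occ | \<pi>. partial_symmetry M i S \<pi>}"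
    by (rule inj_onI) (auto simp: gap_map_perm_restrict intro: gap_map_inj)
next
  fix \<sigma> assume "\<sigma> \<in> gap_map M i ` {perm_restrict \<pi> occ | \<pi>. partial_symmetry M i S \<pi>}"
  then obtain \<pi> where "partial_symmetry M i S \<pi>" "\<sigma> = gap_map M i \<pi>"
    by (auto simp: gap_map_perm_restrict)
  then show "\<sigma> \<in> symmetries (gap M i)"
    by (auto simp: partial_symmetry_def permutes_bij intro!: map_gap_vertex_symmetry)
next
  fix \<sigma> assume sym: "\<sigma> \<in> symmetries (gap M i)"
  then obtain \<pi> where \<pi>: "\<pi> permutes occ"
    and eq: "\<And>v. v \<in> pverts (gap M i) \<Longrightarrow> \<sigma> v = map_gap_vertex \<pi> v"
    by (rule symmetry_induced) blast
  \<comment> \<open>Both \<open>\<sigma>\<close> and the values of \<open>gap_map\<close> are the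
    identity off the graph, so agreement on vertices yields equality of functions.\<close>
  have "\<sigma> v = v" if "v \<notin> pverts (gap M i)" for v
    using sym that by (auto simp: symmetries_def permutes_not_in)
  then have "\<sigma> = gap_map M i (perm_restrict \<pi> occ)"
    using eq unfolding gap_map_perm_restrict by (auto simp: gap_map_def perm_restrict_def)
  then show "\<sigma> \<in> gap_map M i ` {perm_restrict \<pi> occ | \<pi>. partial_symmetry M i S \<pi>}"
    using induced_partial_symmetry[OF assms sym \<pi> eq] by blast
qed

text \<open>If every own atom occurs, then \<open>occ\<close> is the least admissible domain. Off it
  \<open>\<pi>\<close> is already the identity, so restricting changes nothing.\<close>

lemma perm_restrict_partial_symmetry:
  assumes "alph M i \<subseteq> occ" and "partial_symmetry M i (alph M i \<union> at_br (ctx M i)) \<pi>"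
  shows "perm_restrict \<pi> occ = \<pi>"
proof -
  have "occ = alph M i \<union> at_br (ctx M i)"
    using assms(1) occ_subset by (auto simp: occurring_atoms_def)
  then have "\<pi> permutes occ"
    using assms(2) by (simp add: partial_symmetry_def)
  then show ?thesis
    by (auto simp: perm_restrict_def permutes_not_in)
qed

end

theorem theorem3:
  fixes M :: "('a, 'f) mcs" and i :: nat
  assumes "is_mcs M"
    and "i \<in> {1..length M}"
    and "uses_asp (ctx M i)"
  shows "(\<forall>S. admissible_domain M i S \<longrightarrow>
            bij_betw (gap_map M i)
              {perm_restrict \<pi> (occurring_atoms (ctx M i)) | \<pi>. partial_symmetry M i S \<pi>}
              (symmetries (gap M i)))
       \<and> (alph M i \<subseteq> occurring_atoms (ctx M i) \<longrightarrow>
            bij_betw (gap_map M i)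
              {\<pi>. partial_symmetry M i (alph M i \<union> at_br (ctx M i)) \<pi>}
              (symmetries (gap M i)))"
proof -
  interpret asp_context M i
    using assms by unfold_locales
  have "bij_betw (gap_map M i) {\<pi>. partial_symmetry M i (alph M i \<union> at_br (ctx M i)) \<pi>}
      (symmetries (gap M i))" if "alph M i \<subseteq> occ"
  proof -
    have "{perm_restrict \<pi> occ | \<pi>. partial_symmetry M i (alph M i \<union> at_br (ctx M i)) \<pi>} =
        {\<pi>. partial_symmetry M i (alph M i \<union> at_br (ctx M i)) \<pi>}"
      using perm_restrict_partial_symmetry[OF that] by force
    then show ?thesis
      using gap_map_bij[OF admissible_least] by simp
  qed
  then show ?thesis
    using gap_map_bij by blast
qed

end
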